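(* Let $S=S_{g,n}$ with $\xi(S)=3g+n-3>1$, and let $U$ and $V$ be constants depending only on $S$ with properties $(\ast_U)$ and $(\ast_V)$ stated in the context. Let $x,y\in C(S)$, let $d=d_S(x,y)$, and let $g_{x,y}=\{v_i\}_{i=0}^{d}$ be a tight geodesic between $x$ and $y$ with $d_S(x,v_i)=i$ for all $i$. By convention, the factors $i(x,v_1)$ and $i(v_{d-1},y)$ are replaced by $1$ whenever they occur in the products below. Then $$\sqrt[4U]{i(x,v_p)\cdot i(v_p,y)\cdot i(x,v_q)\cdot i(v_q,y)}\;\leq\; i(x,y)\;\leq\;\big(i(x,v_p)\cdot i(v_p,y)\cdot i(x,v_q)\cdot i(v_q,y)\big)^{V}$$ for all $p,q\in\{1,\dots,d-1\}$ with $|p-q|>2$. Furthermore, except for at most $3$ consecutive vertices of $g_{x,y}$, every vertex $v_p$ with $1\le p\le d-1$ satisfies $$\sqrt[2U]{i(x,v_p)\cdot i(v_p,y)}\;\leq\; i(x,y)\;\leq\;\big(i(x,v_p)\cdot i(v_p,y)\big)^{2V}.$$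
   Context: $S_{g,n}$ is a compact (connected, orientable) surface of genus $g$ with $n$ boundary components, $\xi(S_{g,n})=3g+n-3$. Curves are simple, closed, essential, not isotopic into $\partial S$, and considered up to free isotopy. For $\xi(S)>1$ the curve graph $C(S)$ has isotopy classes of curves as vertices, with an edge joining two distinct classes that can be realized disjointly; $d_S$ is the graph metric with edges of length $1$. $x\in C(S)$ means that $x$ is a vertex. $i(x,y)$ is the minimal number of intersection points of $x$ and $y$ over their isotopy classes. A multicurve is a set of mutually disjoint curves. A multigeodesic is a sequence of multicurves $\{V_i\}$ with $d_S(a,b)=|p-q|$ for all $a\in V_p$, $b\in V_q$ and all $p\neq q$. For $A,B\subseteq C(S)$, $F(A,B)$ denotes a regular neighborhood of $A\cup B$ in $S$ (curves in minimal position), and $\partial(F(A,B))$ is understood as the multicurve of isotopy classes of those of its boundary components that are essential in $S$ and not isotopic into $\partial S$. A tight multigeodesic is a multigeodesic with $V_i=\partial(F(V_{i-1},V_{i+1}))$ for every $i$ that is not an endpoint index. A tight geodesic between $x$ and $y$ is a geodesic $\{v_i\}$ such that $v_i\in V_i$ for all $i$, for some tight multigeodesic $\{V_i\}$ between $x$ and $y$ (i.e. with first term $\{x\}$ and last term $\{y\}$). Constants depending only on $S$ with the following properties exist by theorems of the paper. $(\ast_U)$: for all $x,y\in C(S)$ and every tight geodesic $\{v_i\}$ between $x$ and $y$ with $d_S(x,v_i)=i$ for all $i$, one has $i(v_p,v_q)\leq i(x,y)^{U}$ for all $p,q$. $(\ast_V)$: for all $x,y\in C(S)$ with $d=d_S(x,y)$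 and every geodesic (not necessarily tight) $\{v_i\}_{i=0}^{d}$ between $x$ and $y$ with $d_S(x,v_i)=i$ for all $i$, one has $i(x,y)\leq \big(i(x,v_p)\, i(v_p,y)\, i(x,v_q)\, i(v_q,y)\big)^{V}$ for all $p,q\in\{1,\dots,d-1\}$ with $|p-q|>2$, with the convention that the factors $i(x,v_1)$ and $i(v_{d-1},y)$ are replaced by $1$ on the right-hand side. *)

theory Defs
  imports "HOL-Complex_Analysis.Winding_Numbers"
begin

section \<open>Compact orientable surfaces\<close>

definition surface_with_boundary :: "'a topology \<Rightarrow> bool" where
  "surface_with_boundary X \<longleftrightarrow>
     Hausdorff_space X \<and> second_countable X \<and>
     (\<forall>x \<in> topspace X. \<exists>U W. openin X U \<and> x \<in> U \<and>
        openin (top_of_set {z::complex. 0 \<le> Im z}) W \<and>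
        subtopology X U homeomorphic_space top_of_set W)"

definition surface_interior :: "'a topology \<Rightarrow> 'a set" where
  "surface_interior X =
     {x \<in> topspace X. \<exists>U W. openin X U \<and> x \<in> U \<and> open (W :: complex set) \<and>
        subtopology X U homeomorphic_space top_of_set W}"

definition surface_boundary :: "'a topology \<Rightarrow> 'a set" where
  "surface_boundary X = topspace X - surface_interior X"

definition interior_chart :: "'a topology \<Rightarrow> 'a set \<Rightarrow> ('a \<Rightarrow> complex) \<Rightarrow> bool" where
  "interior_chart X U \<phi> \<longleftrightarrow>
     openin X U \<and> U \<subseteq> surface_interior X \<and> open (\<phi> ` U) \<and>
     homeomorphic_map (subtopology X U) (top_of_set (\<phi> ` U)) \<phi>"

text \<open>The transition map from \<open>\<phi>\<close> to \<open>\<psi>\<close> preserves orientation near \<open>x\<close> if it sends small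
  counterclockwise circles around \<open>\<phi> x\<close> to loops winding once counterclockwise around \<open>\<psi> x\<close>
  (this is local degree 1; a homeomorphism always has local degree 1 or -1).\<close>

definition orientation_preserving_at ::
    "'a set \<Rightarrow> ('a \<Rightarrow> complex) \<Rightarrow> ('a \<Rightarrow> complex) \<Rightarrow> 'a \<Rightarrow> bool" where
  "orientation_preserving_at U \<phi> \<psi> x \<longleftrightarrow>
     (\<forall>\<^sub>F r in at_right 0.
        winding_number (\<lambda>t. \<psi> (inv_into U \<phi> (circlepath (\<phi> x) r t))) (\<psi> x) = 1)"

text \<open>A surface with boundary is orientable iff its interior is, so only interior charts are used.\<close>

definition orientable_surface :: "'a topology \<Rightarrow> bool" where
  "orientable_surface X \<longleftrightarrow>
     (\<exists>\<A>. (\<forall>(U, \<phi>) \<in> \<A>. interior_chart X U \<phi>) \<and>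
          (\<Union>(U, \<phi>) \<in> \<A>. U) = surface_interior X \<and>
          (\<forall>(U, \<phi>) \<in> \<A>. \<forall>(W, \<psi>) \<in> \<A>. \<forall>x \<in> U \<inter> W. orientation_preserving_at U \<phi> \<psi> x))"

abbreviation circle_topology :: "complex topology" where
  "circle_topology \<equiv> top_of_set (sphere 0 1)"

definition simple_closed_curve :: "'a topology \<Rightarrow> 'a set \<Rightarrow> bool" where
  "simple_closed_curve X c \<longleftrightarrow> (\<exists>f. embedding_map circle_topology X f \<and> f ` sphere 0 1 = c)"

text \<open>The genus is the maximal number of pairwise disjoint simple closed curves in the interior
  whose union does not separate the surface. (Curves in the boundary never separate, hence the
  restriction to the interior.)\<close>

definition nonseparating_system :: "'a topology \<Rightarrow> 'a set set \<Rightarrow> bool" where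
  "nonseparating_system X \<C> \<longleftrightarrow>
     finite \<C> \<and> disjoint \<C> \<and>
     (\<forall>c \<in> \<C>. simple_closed_curve X c \<and> c \<subseteq> surface_interior X) \<and>
     connected_space (subtopology X (topspace X - \<Union>\<C>))"

definition has_genus :: "'a topology \<Rightarrow> nat \<Rightarrow> bool" where
  "has_genus X g \<longleftrightarrow>
     (\<exists>\<C>. nonseparating_system X \<C> \<and> card \<C> = g) \<and>
     (\<forall>\<C>. nonseparating_system X \<C> \<longrightarrow> card \<C> \<le> g)"

definition surface_of_type :: "'a topology \<Rightarrow> nat \<Rightarrow> nat \<Rightarrow> bool" where
  "surface_of_type X g n \<longleftrightarrow>
     topspace X \<noteq> {} \<and> surface_with_boundary X \<and> compact_space X \<and> connected_space X \<and>
     orientable_surface X \<and> has_genus X g \<and>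
     finite (connected_components_of (subtopology X (surface_boundary X))) \<and>
     card (connected_components_of (subtopology X (surface_boundary X))) = n"

definition surface_complexity :: "nat \<Rightarrow> nat \<Rightarrow> int" where
  "surface_complexity g n = 3 * int g + int n - 3"

section \<open>Curves and the curve graph\<close>

text \<open>Free isotopy of unoriented simple closed curves: a homotopy through embeddings between
  some parametrisations of the two curves.\<close>

definition isotopic :: "'a topology \<Rightarrow> 'a set \<Rightarrow> 'a set \<Rightarrow> bool" where
  "isotopic X a b \<longleftrightarrow>
     (\<exists>f h. f ` sphere 0 1 = a \<and> h ` sphere 0 1 = b \<and>
        homotopic_with (embedding_map circle_topology X) circle_topology X f h)"

definition null_homotopic :: "'a topology \<Rightarrow> 'a set \<Rightarrow> bool" where
  "null_homotopic X c \<longleftrightarrow>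
     (\<exists>f p. embedding_map circle_topology X f \<and> f ` sphere 0 1 = c \<and>
        homotopic_with (\<lambda>_. True) circle_topology X f (\<lambda>_. p))"

definition essential_curve :: "'a topology \<Rightarrow> 'a set \<Rightarrow> bool" where
  "essential_curve X c \<longleftrightarrow>
     simple_closed_curve X c \<and> \<not> null_homotopic X c \<and>
     \<not> (\<exists>b \<subseteq> surface_boundary X. isotopic X c b)"

definition isotopy_class :: "'a topology \<Rightarrow> 'a set \<Rightarrow> 'a set set" where
  "isotopy_class X c = {b. isotopic X c b}"

definition curves :: "'a topology \<Rightarrow> 'a set set set" where
  "curves X = {isotopy_class X c | c. essential_curve X c}"

definition curve_graph_edges :: "'a topology \<Rightarrow> ('a set set \<times> 'a set set) set" where
  "curve_graph_edges X =
     {(x, y). x \<in> curves X \<and> y \<in> curves X \<and> x \<noteq> y \<and> (\<exists>a \<in> x. \<exists>b \<in> y. a \<inter> b = {})}"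

text \<open>Length of a shortest edge path. The curve graph is connected whenever the complexity of the
  surface exceeds 1, so the minimum exists for all pairs of vertices.\<close>

definition curve_dist :: "'a topology \<Rightarrow> 'a set set \<Rightarrow> 'a set set \<Rightarrow> nat" where
  "curve_dist X x y = (LEAST k. (x, y) \<in> curve_graph_edges X ^^ k)"

text \<open>Finiteness is required explicitly because \<^const>\<open>card\<close> is 0 on infinite sets; any two classes
  have representatives with finite intersection.\<close>

definition intersection_number :: "'a topology \<Rightarrow> 'a set set \<Rightarrow> 'a set set \<Rightarrow> nat" where
  "intersection_number X x y =
     (LEAST k. \<exists>a \<in> x. \<exists>b \<in> y. finite (a \<inter> b) \<and> card (a \<inter> b) = k)"

section \<open>Regular neighborhoods, tight multigeodesics and tight geodesics\<close>

definition multicurve :: "'a topology \<Rightarrow> 'a set set set \<Rightarrow> bool" where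
  "multicurve X M \<longleftrightarrow>
     M \<subseteq> curves X \<and> (\<forall>x \<in> M. \<forall>y \<in> M. x \<noteq> y \<longrightarrow> (x, y) \<in> curve_graph_edges X)"

text \<open>A regular neighborhood of \<open>K\<close> is a compact subsurface \<open>N\<close> with \<open>K\<close> in its interior such that
  \<open>N - K\<close> is an open collar of the boundary curves of \<open>N\<close>, i.e. \<open>N\<close> minus its boundary curves
  shrinks onto \<open>K\<close> along half-open annuli. For a finite graph \<open>K\<close> in the interior of the
  surface this determines \<open>N\<close> up to isotopy.\<close>

definition regular_neighborhood :: "'a topology \<Rightarrow> 'a set \<Rightarrow> 'a set \<Rightarrow> bool" where
  "regular_neighborhood X K N \<longleftrightarrow>
     closedin X N \<and> N \<subseteq> surface_interior X \<and> K \<subseteq> X interior_of N \<and>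
     finite (connected_components_of (subtopology X (X frontier_of N))) \<and>
     (\<forall>c \<in> connected_components_of (subtopology X (X frontier_of N)). simple_closed_curve X c) \<and>
     (\<exists>h. homeomorphic_map
            (prod_topology (subtopology X (X frontier_of N)) (top_of_set {0..<1::real}))
            (subtopology X (N - K)) h \<and>
          (\<forall>x \<in> X frontier_of N. h (x, 0) = x))"

definition minimal_position :: "'a topology \<Rightarrow> 'a set set set \<Rightarrow> ('a set set \<Rightarrow> 'a set) \<Rightarrow> bool" where
  "minimal_position X M r \<longleftrightarrow>
     (\<forall>x \<in> M. r x \<in> x \<and> r x \<subseteq> surface_interior X) \<and>
     (\<forall>x \<in> M. \<forall>y \<in> M. x \<noteq> y \<longrightarrow>
        finite (r x \<inter> r y) \<and> card (r x \<inter> r y) = intersection_number X x y)"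

text \<open>\<open>is_F X A B N\<close>: the set \<open>N\<close> is one of the choices for \<open>F(A, B)\<close>.\<close>

definition is_F :: "'a topology \<Rightarrow> 'a set set set \<Rightarrow> 'a set set set \<Rightarrow> 'a set \<Rightarrow> bool" where
  "is_F X A B N \<longleftrightarrow>
     (\<exists>r. minimal_position X (A \<union> B) r \<and> regular_neighborhood X (\<Union>(r ` (A \<union> B))) N)"

definition boundary_multicurve :: "'a topology \<Rightarrow> 'a set \<Rightarrow> 'a set set set" where
  "boundary_multicurve X N =
     {isotopy_class X c | c.
        c \<in> connected_components_of (subtopology X (X frontier_of N)) \<and> essential_curve X c}"

text \<open>Sequences indexed by \<open>0, \<dots>, d\<close> are functions on \<^typ>\<open>nat\<close>; values beyond \<open>d\<close> are
  irrelevant.\<close>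

definition multigeodesic :: "'a topology \<Rightarrow> nat \<Rightarrow> (nat \<Rightarrow> 'a set set set) \<Rightarrow> bool" where
  "multigeodesic X d M \<longleftrightarrow>
     (\<forall>i \<le> d. multicurve X (M i)) \<and>
     (\<forall>p \<le> d. \<forall>q \<le> d. p \<noteq> q \<longrightarrow>
        (\<forall>a \<in> M p. \<forall>b \<in> M q. int (curve_dist X a b) = \<bar>int p - int q\<bar>))"

definition tight_multigeodesic :: "'a topology \<Rightarrow> nat \<Rightarrow> (nat \<Rightarrow> 'a set set set) \<Rightarrow> bool" where
  "tight_multigeodesic X d M \<longleftrightarrow>
     multigeodesic X d M \<and>
     (\<forall>i. 0 < i \<and> i < d \<longrightarrow>
        (\<exists>N. is_F X (M (i - 1)) (M (i + 1)) N \<and> M i = boundary_multicurve X N))"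

definition geodesic_between ::
    "'a topology \<Rightarrow> 'a set set \<Rightarrow> 'a set set \<Rightarrow> (nat \<Rightarrow> 'a set set) \<Rightarrow> bool" where
  "geodesic_between X x y v \<longleftrightarrow>
     v 0 = x \<and> v (curve_dist X x y) = y \<and>
     (\<forall>i \<le> curve_dist X x y. v i \<in> curves X) \<and>
     (\<forall>i < curve_dist X x y. (v i, v (Suc i)) \<in> curve_graph_edges X)"

definition tight_geodesic_between ::
    "'a topology \<Rightarrow> 'a set set \<Rightarrow> 'a set set \<Rightarrow> (nat \<Rightarrow> 'a set set) \<Rightarrow> bool" where
  "tight_geodesic_between X x y v \<longleftrightarrow>
     geodesic_between X x y v \<and>
     (\<exists>M. tight_multigeodesic X (curve_dist X x y) M \<and>
          M 0 = {x} \<and> M (curve_dist X x y) = {y} \<and>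
          (\<forall>i \<le> curve_dist X x y. v i \<in> M i))"

section \<open>The constants\<close>

definition property_U :: "'a topology \<Rightarrow> real \<Rightarrow> bool" where
  "property_U X U \<longleftrightarrow>
     (\<forall>x \<in> curves X. \<forall>y \<in> curves X. \<forall>v.
        tight_geodesic_between X x y v \<and>
        (\<forall>i \<le> curve_dist X x y. curve_dist X x (v i) = i) \<longrightarrow>
        (\<forall>p \<le> curve_dist X x y. \<forall>q \<le> curve_dist X x y.
           real (intersection_number X (v p) (v q)) \<le> real (intersection_number X x y) powr U))"

text \<open>\<open>i(x, v\<^sub>p) \<cdot> i(v\<^sub>p, y)\<close> with the convention that the factors \<open>i(x, v\<^sub>1)\<close> and
  \<open>i(v\<^bsub>d-1\<^esub>, y)\<close>, which vanish, are replaced by 1.\<close>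

definition intersection_product ::
    "'a topology \<Rightarrow> 'a set set \<Rightarrow> 'a set set \<Rightarrow> (nat \<Rightarrow> 'a set set) \<Rightarrow> nat \<Rightarrow> real" where
  "intersection_product X x y v p =
     (if p = 1 then 1 else real (intersection_number X x (v p))) *
     (if p = curve_dist X x y - 1 then 1 else real (intersection_number X (v p) y))"

definition property_V :: "'a topology \<Rightarrow> real \<Rightarrow> bool" where
  "property_V X V \<longleftrightarrow>
     (\<forall>x \<in> curves X. \<forall>y \<in> curves X. \<forall>v.
        geodesic_between X x y v \<and>
        (\<forall>i \<le> curve_dist X x y. curve_dist X x (v i) = i) \<longrightarrow>
        (\<forall>p \<in> {1..curve_dist X x y - 1}. \<forall>q \<in> {1..curve_dist X x y - 1}.
           \<bar>int p - int q\<bar> > 2 \<longrightarrow>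
           real (intersection_number X x y)
             \<le> (intersection_product X x y v p * intersection_product X x y v q) powr V))"

end

theory Submission
  imports Defs
begin

text \<open>Write \<open>N = i(x, y)\<close> and let \<open>P\<^sub>p\<close> be the product \<open>i(x, v\<^sub>p) \<cdot> i(v\<^sub>p, y)\<close> with its convention.
  Since \<open>x\<close> and \<open>y\<close> are themselves terms of the tight geodesic, property \<open>(\<ast>\<^sub>U)\<close> bounds each genuine
  factor of \<open>P\<^sub>p\<close> by \<open>N\<^sup>U\<close>, so \<open>P\<^sub>p \<le> N\<^sup>2\<^sup>U\<close> once \<open>d \<ge> 3\<close>
  (\<open>intersection_product_le_powr\<close>). Taking roots yields both lower bounds; for \<open>d \<le> 2\<close> there is
  no pair of indices to consider, and the exceptional set can contain every interior vertex.
  The upper bound for two indices is property \<open>(\<ast>\<^sub>V)\<close> itself.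

  For the upper bound at a single index, call \<open>p\<close> bad if \<open>P\<^sub>p\<^sup>2\<^sup>V < N\<close>. If \<open>p\<close> and \<open>q\<close> were bad and
  more than 2 apart, multiplying the two inequalities and taking square roots would give
  \<open>(P\<^sub>p P\<^sub>q)\<^sup>V < N\<close>, against \<open>(\<ast>\<^sub>V)\<close> (\<open>less_powr_mult\<close>). So any two bad indices differ by at most 2,
  and all of them lie among three consecutive integers.\<close>

lemma subset_three_consecutive:
  fixes B :: "nat set"
  assumes "\<And>p q. p \<in> B \<Longrightarrow> q \<in> B \<Longrightarrow> \<bar>int p - int q\<bar> \<le> 2"
  shows "\<exists>k. B \<subseteq> {k..k + 2}"
proof (cases "B = {}")
  case False
  define k where "k = (LEAST p. p \<in> B)"
  have "k \<in> B"
    unfolding k_def using False by (meson LeastI ex_in_conv)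
  have "k \<le> p" if "p \<in> B" for p
    unfolding k_def using that by (rule Least_le)
  moreover have "p \<le> k + 2" if "p \<in> B" for p
    using assms[OF that \<open>k \<in> B\<close>] by linarith
  ultimately have "B \<subseteq> {k..k + 2}"
    by auto
  then show ?thesis ..
qed simp

lemma powr_inverse_exponent_le:
  fixes a N e :: real
  assumes "0 \<le> a" "0 \<le> N" "0 < e" "a \<le> N powr e"
  shows "a powr (1 / e) \<le> N"
proof -
  have "a powr (1 / e) \<le> (N powr e) powr (1 / e)"
    using assms by (intro powr_mono2) auto
  also have "\<dots> = N"
    using assms by (simp add: powr_powr)
  finally show ?thesis .
qed

lemma less_powr_mult:
  fixes a b N V :: real
  assumes "0 \<le> a" "0 \<le> b" "a powr (2 * V) < N" "b powr (2 * V) < N"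
  shows "(a * b) powr V < N"
proof -
  have square: "t powr (2 * V) = (t powr V)\<^sup>2" for t :: real
    by (simp add: power2_eq_square flip: powr_add)
  have "((a * b) powr V)\<^sup>2 = a powr (2 * V) * b powr (2 * V)"
    using assms by (simp add: powr_mult power_mult_distrib square)
  also have "\<dots> < N * N"
    using assms by (intro mult_strict_mono') auto
  finally have "((a * b) powr V)\<^sup>2 < N\<^sup>2"
    by (simp add: power2_eq_square)
  moreover have "0 \<le> N"
    using assms(3) powr_ge_zero[of a "2 * V"] by linarith
  ultimately show ?thesis
    by (rule power_less_imp_less_base)
qed

lemma intersection_product_nonneg: "0 \<le> intersection_product X x y v p"
  by (simp add: intersection_product_def)

text \<open>A factor that the convention replaces by 1 obeys the bound \<open>i(x, y)\<^sup>U\<close> only when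
  \<open>i(x, y) \<ge> 1\<close>. At distance at least 3 no index has both factors replaced; hence if
  \<open>i(x, y) = 0\<close>, the remaining factor vanishes by \<open>(\<ast>\<^sub>U)\<close>, and with it the product.\<close>

lemma intersection_product_le_powr:
  assumes U: "property_U X U" "U > 0"
    and xy: "x \<in> curves X" "y \<in> curves X"
    and tight: "tight_geodesic_between X x y v"
    and dist: "\<forall>i \<le> curve_dist X x y. curve_dist X x (v i) = i"
    and far: "3 \<le> curve_dist X x y"
    and p: "p \<le> curve_dist X x y"
  shows "intersection_product X x y v p \<le> real (intersection_number X x y) powr (2 * U)"
proof -
  define N where "N = real (intersection_number X x y)"
  have ends: "v 0 = x" "v (curve_dist X x y) = y"
    using tight by (auto simp: tight_geodesic_between_def geodesic_between_def)
  have bound: "real (intersection_number X (v i) (v j)) \<le> N powr U"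
    if "i \<le> curve_dist X x y" "j \<le> curve_dist X x y" for i j
    using U(1)[unfolded property_U_def, rule_format, OF xy, of v] tight dist that
    by (simp add: N_def)
  have left: "real (intersection_number X x (v p)) \<le> N powr U"
    using bound[of 0 p] p ends by simp
  have right: "real (intersection_number X (v p) y) \<le> N powr U"
    using bound[of p "curve_dist X x y"] p ends by simp
  have "intersection_product X x y v p \<le> N powr U * N powr U"
  proof (cases "N = 0")
    case True
    then show ?thesis
      using left right far by (auto simp: intersection_product_def)
  next
    case False
    then have "1 \<le> N"
      unfolding N_def by simp
    then have "1 \<le> N powr U"
      using U(2) by (intro ge_one_powr_ge_zero) auto
    then show ?thesis
      unfolding intersection_product_def using left right
      by (intro mult_mono) auto
  qed
  then show ?thesis
    by (simp add: N_def flip: powr_add)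
qed

theorem corollary1p8:
  fixes S :: "'a topology" and g n :: nat and U V :: real
    and x y :: "'a set set" and v :: "nat \<Rightarrow> 'a set set" and d :: nat
  assumes "surface_of_type S g n"
    and "surface_complexity g n > 1"
    and "U > 0" and "V > 0"
    and "property_U S U"
    and "property_V S V"
    and "x \<in> curves S" and "y \<in> curves S"
    and "d = curve_dist S x y"
    and "tight_geodesic_between S x y v"
    and "\<forall>i \<le> d. curve_dist S x (v i) = i"
  shows "(\<forall>p \<in> {1..d - 1}. \<forall>q \<in> {1..d - 1}. \<bar>int p - int q\<bar> > 2 \<longrightarrow>
            (intersection_product S x y v p * intersection_product S x y v q) powr (1 / (4 * U))
              \<le> real (intersection_number S x y) \<and>
            real (intersection_number S x y)
              \<le> (intersection_product S x y v p * intersection_product S x y v q) powr V)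
         \<and>
         (\<exists>k. \<forall>p \<in> {1..d - 1} - {k..k + 2}.
            intersection_product S x y v p powr (1 / (2 * U))
              \<le> real (intersection_number S x y) \<and>
            real (intersection_number S x y)
              \<le> intersection_product S x y v p powr (2 * V))"
proof -
  let ?P = "intersection_product S x y v" and ?N = "real (intersection_number S x y)"
  note d = \<open>d = curve_dist S x y\<close>
  have upper: "?N \<le> (?P p * ?P q) powr V"
    if "p \<in> {1..d - 1}" "q \<in> {1..d - 1}" "\<bar>int p - int q\<bar> > 2" for p q
    using assms(6)[unfolded property_V_def, rule_format, OF assms(7,8), of v p q] assms(9-11) that
    by (simp add: tight_geodesic_between_def)
  have product: "?P p \<le> ?N powr (2 * U)" if "3 \<le> d" "p \<in> {1..d - 1}" for p
    using assms(3,5,7-11) that by (intro intersection_product_le_powr) auto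
  have lower2: "(?P p * ?P q) powr (1 / (4 * U)) \<le> ?N"
    if "3 \<le> d" "p \<in> {1..d - 1}" "q \<in> {1..d - 1}" for p q
  proof -
    have "?P p * ?P q \<le> ?N powr (2 * U) * ?N powr (2 * U)"
      using that by (intro mult_mono product intersection_product_nonneg) auto
    then have "?P p * ?P q \<le> ?N powr (4 * U)"
      by (simp flip: powr_add)
    then show ?thesis
      using \<open>U > 0\<close> by (intro powr_inverse_exponent_le) (auto simp: intersection_product_nonneg)
  qed
  have lower1: "?P p powr (1 / (2 * U)) \<le> ?N" if "3 \<le> d" "p \<in> {1..d - 1}" for p
    using \<open>U > 0\<close> product[OF that]
    by (intro powr_inverse_exponent_le) (auto simp: intersection_product_nonneg)
  have "\<exists>k. \<forall>p \<in> {1..d - 1} - {k..k + 2}.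
          ?P p powr (1 / (2 * U)) \<le> ?N \<and> ?N \<le> ?P p powr (2 * V)"
  proof (cases "3 \<le> d")
    case True
    define B where "B = {p \<in> {1..d - 1}. ?P p powr (2 * V) < ?N}"
    have "\<bar>int p - int q\<bar> \<le> 2" if "p \<in> B" "q \<in> B" for p q
    proof (rule ccontr)
      assume "\<not> \<bar>int p - int q\<bar> \<le> 2"
      with that have "?N \<le> (?P p * ?P q) powr V"
        by (intro upper) (auto simp: B_def)
      moreover have "(?P p * ?P q) powr V < ?N"
        using that by (intro less_powr_mult intersection_product_nonneg) (auto simp: B_def)
      ultimately show False
        by simp
    qed
    then obtain k where "B \<subseteq> {k..k + 2}"
      using subset_three_consecutive by blast
    then show ?thesis
      using lower1[OF True] by (intro exI[of _ k]) (auto simp: B_def subset_iff not_less)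
  next
    \<comment> \<open>There is at most one interior vertex, so it may be one of the three exceptions.\<close>
    case False
    then have "{1..d - 1} - {1..1 + 2} = {}"
      by auto
    then show ?thesis
      by (intro exI[of _ 1]) (simp only: ball_simps)
  qed
  \<comment> \<open>Two interior indices more than 2 apart force \<open>d \<ge> 5\<close>.\<close>
  moreover have "3 \<le> d"
    if "p \<in> {1..d - 1}" "q \<in> {1..d - 1}" "\<bar>int p - int q\<bar> > 2" for p q
    using that by auto
  ultimately show ?thesis
    using upper lower2 by simp
qed

end
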